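(* Let $q=p^n$ where $p$ is a prime, let $\theta$ be a primitive element of $GF(q)$, and let $k\geq 4$ and $r\geq 1$ be integers with $q-1=kr$. Let $B:=\langle\theta^r\rangle\subseteq GF(q)$. Then the orbit of $B$ under the action of $PGL(2,q)$ on the $k$-subsets of $X=GF(q)\cup\{\infty\}$ is (the block set of) a simple $3$-$(q+1,k,\lambda)$ design on $X$, where $$\lambda=\begin{cases}(k-1)(k-2)/2 & \text{if } k-1 \text{ does not divide } q,\\ 1 & \text{if } k-1 \text{ divides } q.\end{cases}$$
   Context: $PGL(2,q)$ is the group of maps $x\mapsto \frac{ax+b}{cx+d}$ on $X=GF(q)\cup\{\infty\}$ with $a,b,c,d\in GF(q)$, $ad-bc\neq 0$, with the usual conventions for $\infty$. $\langle\theta^r\rangle$ denotes the multiplicative subgroup of $GF(q)^*$ generated by $\theta^r$ (of order $k$). A $3$-$(v,k,\lambda)$ design is a pair $(X,\mathcal{B})$ with $|X|=v$ and $\mathcal{B}$ a collection of $k$-subsets (blocks) of $X$ such that every $3$-subset of $X$ lies in exactly $\lambda$ blocks; it is simple if $\mathcal{B}$ has no repeated blocks. *)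

theory Defs
  imports
    "HOL-Algebra.Group_Action"
    "HOL-Computational_Algebra.Primes"
    "HOL-Library.Cardinality"
    "HOL-Library.Multiset"
begin

text \<open>The field \<open>GF(q)\<close> is a type \<open>'a :: {field, finite}\<close>. The projective line
  \<open>GF(q) \<union> {\<infinity>}\<close> is \<open>'a option\<close>, with \<open>None\<close> as the point \<open>\<infinity>\<close>.\<close>

fun linear_fractional :: "'a::field \<Rightarrow> 'a \<Rightarrow> 'a \<Rightarrow> 'a \<Rightarrow> 'a option \<Rightarrow> 'a option" where
  "linear_fractional a b c d None = (if c = 0 then None else Some (a / c))"
| "linear_fractional a b c d (Some x) =
     (if c * x + d = 0 then None else Some ((a * x + b) / (c * x + d)))"

definition PGL2 :: "('a::field option \<Rightarrow> 'a option) monoid" where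
  "PGL2 = \<lparr>carrier = {linear_fractional a b c d | a b c d. a * d - b * c \<noteq> 0},
           monoid.mult = (\<circ>), one = id\<rparr>"

definition cyclic_subgroup :: "'a::field \<Rightarrow> 'a set" where
  "cyclic_subgroup g = {g powi i | i. True}"

definition primitive_element :: "'a::field \<Rightarrow> bool" where
  "primitive_element \<theta> \<longleftrightarrow> \<theta> \<noteq> 0 \<and> cyclic_subgroup \<theta> = UNIV - {0}"

text \<open>Blocks form a multiset, so that a design may a priori have repeated blocks.\<close>

definition is_3_design :: "nat \<Rightarrow> nat \<Rightarrow> nat \<Rightarrow> 'x set \<Rightarrow> 'x set multiset \<Rightarrow> bool" where
  "is_3_design v k l X \<B> \<longleftrightarrow>
     finite X \<and> card X = v \<and>
     (\<forall>b \<in># \<B>. b \<subseteq> X \<and> card b = k) \<and>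
     (\<forall>T. T \<subseteq> X \<and> card T = 3 \<longrightarrow> size {#b \<in># \<B>. T \<subseteq> b#} = l)"

definition simple_design :: "'x set multiset \<Rightarrow> bool" where
  "simple_design \<B> \<longleftrightarrow> (\<forall>b. count \<B> b \<le> 1)"

end

theory Submission
  imports
    Defs
    "HOL-Algebra.Exponent"
    "HOL-Computational_Algebra.Polynomial"
    "HOL-Number_Theory.Residues"
begin

text \<open>If a group acts sharply 3-transitively, then by double counting the number \<open>\<lambda>\<close> of images of \<open>B\<close>
  containing a given triple satisfies \<open>\<lambda> |Stab B| = k (k - 1) (k - 2)\<close>, so everything reduces to the
  order of the stabilizer in \<open>PGL(2,q)\<close> of the group \<open>B\<close> of \<open>k\<close>-th roots of unity. The map
  \<open>x \<mapsto> (a x + b) / (c x + d)\<close> sends \<open>x \<in> B\<close> into \<open>B\<close> iff \<open>(a x + b)\<^sup>k = (c x + d)\<^sup>k\<close>.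

  If \<open>k - 1\<close> is a power of the characteristic, this condition is quadratic on \<open>B\<close>, so a map sending
  three points of \<open>B\<close> into \<open>B\<close> stabilizes \<open>B\<close>, and the stabilizer has order \<open>k (k - 1) (k - 2)\<close>.

  Otherwise \<open>k - 1 = s t\<close> with \<open>s\<close> a power of the characteristic \<open>p\<close> and \<open>t \<ge> 2\<close> prime to \<open>p\<close>. For an
  element of the stabilizer, \<open>(a X + b)\<^sup>k - (c X + d)\<^sup>k\<close> vanishes on \<open>B\<close> and hence is a multiple of
  \<open>X\<^sup>k - 1\<close>. Its coefficients at \<open>X\<close> and \<open>X\<^bsup>s + 1\<^esup>\<close> involve binomial coefficients prime to \<open>p\<close>,
  and their vanishing forces \<open>(a d)\<^sup>s = (b c)\<^sup>s\<close> unless the matrix is diagonal or antidiagonal. So the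
  stabilizer is dihedral of order \<open>2 k\<close>.\<close>

section \<open>Sharply transitive actions\<close>

definition arrangements :: "nat \<Rightarrow> 'a set \<Rightarrow> 'a list set" where
  "arrangements n A = {xs. length xs = n \<and> distinct xs \<and> set xs \<subseteq> A}"

lemma card_arrangements_3:
  assumes "card A \<ge> 3"
  shows "card (arrangements 3 A) = card A * (card A - 1) * (card A - 2)"
proof -
  have "finite A" using assms by (metis card.infinite not_numeral_le_zero)
  then have "card (arrangements 3 A) = \<Prod>{card A - 3 + 1..card A}"
    using assms unfolding arrangements_def by (rule card_lists_distinct_length_eq)
  moreover obtain m where "card A = m + 3" using assms by (metis add.commute le_Suc_ex)
  ultimately show ?thesis by (simp add: numeral_3_eq_3 atLeastAtMostSuc_conv algebra_simps)
qed

lemma arrangements_3E: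
  assumes "xs \<in> arrangements 3 A"
  obtains x y z where "xs = [x, y, z]" "distinct [x, y, z]"
  using assms by (auto simp: arrangements_def numeral_3_eq_3 length_Suc_conv)

context group_action
begin

abbreviation set_action :: "'a \<Rightarrow> 'c set \<Rightarrow> 'c set" where
  "set_action \<equiv> \<lambda>g. (`) (\<phi> g)"

interpretation group G
  using group_hom by (rule group_hom.axioms(1))

lemma inv_action: "\<lbrakk>g \<in> carrier G; x \<in> E\<rbrakk> \<Longrightarrow> \<phi> (inv g) (\<phi> g x) = x"
  by (rule orbit_sym_aux) simp_all

lemma set_action_mult:
  assumes "B \<subseteq> E" "g \<in> carrier G" "h \<in> carrier G"
  shows "\<phi> (g \<otimes> h) ` B = \<phi> g ` \<phi> h ` B"
  unfolding image_image using assms by (intro image_cong) (auto simp: composition_rule)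

lemma set_action_inv:
  assumes "B \<subseteq> E" "g \<in> carrier G"
  shows "\<phi> (inv g) ` \<phi> g ` B = B"
  using assms by (force simp: image_image inv_action)

lemma set_action_subset:
  assumes "B \<subseteq> E" "g \<in> carrier G"
  shows "\<phi> g ` B \<subseteq> E"
  using assms element_image by blast

lemma card_set_action:
  assumes "B \<subseteq> E" "g \<in> carrier G"
  shows "card (\<phi> g ` B) = card B"
  using assms inj_prop by (meson card_image inj_on_subset)

lemma subset_set_action_iff:
  assumes "B \<subseteq> E" "T \<subseteq> E" "g \<in> carrier G"
  shows "T \<subseteq> \<phi> g ` B \<longleftrightarrow> \<phi> (inv g) ` T \<subseteq> B"
proof
  assume "T \<subseteq> \<phi> g ` B"
  then have "\<phi> (inv g) ` T \<subseteq> \<phi> (inv g) ` \<phi> g ` B" by (rule image_mono)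
  then show "\<phi> (inv g) ` T \<subseteq> B" using assms by (simp add: set_action_inv)
next
  assume "\<phi> (inv g) ` T \<subseteq> B"
  then have "\<phi> g ` \<phi> (inv g) ` T \<subseteq> \<phi> g ` B" by (rule image_mono)
  then show "T \<subseteq> \<phi> g ` B" using assms set_action_inv[of T "inv g"] by simp
qed

lemma mem_stabilizer_set_action_iff:
  assumes "B \<subseteq> E" "finite B" "g \<in> carrier G"
  shows "g \<in> stabilizer G set_action B \<longleftrightarrow> \<phi> g ` B \<subseteq> B"
  using assms card_set_action card_subset_eq[of B "\<phi> g ` B"] by (auto simp: stabilizer_def)

lemma card_set_action_fibre:
  assumes "B \<subseteq> E" "g \<in> carrier G"
  shows "card {h \<in> carrier G. \<phi> h ` B = \<phi> g ` B} = card (stabilizer G set_action B)"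
proof -
  have "bij_betw (\<lambda>h. g \<otimes> h) (stabilizer G set_action B) {h \<in> carrier G. \<phi> h ` B = \<phi> g ` B}"
    by (rule bij_betwI[where g = "\<lambda>h. inv g \<otimes> h"])
      (use assms in \<open>auto simp: stabilizer_def set_action_mult set_action_inv m_assoc[symmetric]\<close>)
  then show ?thesis by (simp add: bij_betw_same_card)
qed

lemma card_blocks_times_card_stabilizer:
  assumes "finite (carrier G)" "B \<subseteq> E" "T \<subseteq> E"
  shows "card {b \<in> orbit G set_action B. T \<subseteq> b} * card (stabilizer G set_action B)
    = card {g \<in> carrier G. \<phi> g ` T \<subseteq> B}"
proof -
  let ?S = "{g \<in> carrier G. T \<subseteq> \<phi> g ` B}" and ?blocks = "{b \<in> orbit G set_action B. T \<subseteq> b}"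
  have "?S = {g \<in> carrier G. \<phi> (inv g) ` T \<subseteq> B}" using subset_set_action_iff[OF assms(2,3)] by blast
  then have "bij_betw (\<lambda>g. inv g) ?S {g \<in> carrier G. \<phi> g ` T \<subseteq> B}"
    by (intro bij_betwI[where g = "\<lambda>g. inv g"]) simp_all
  then have "card {g \<in> carrier G. \<phi> g ` T \<subseteq> B} = card ?S" by (simp add: bij_betw_same_card)
  also have "\<dots> = (\<Sum>g\<in>?S. 1)" by simp
  also have "\<dots> = (\<Sum>b\<in>?blocks. \<Sum>g\<in>{g \<in> ?S. \<phi> g ` B = b}. 1)"
  proof (rule sum.group[symmetric])
    show "finite ?blocks" using assms(1) by (simp add: orbit_def)
  qed (use assms in \<open>auto simp: orbit_def\<close>)
  also have "\<dots> = (\<Sum>b\<in>?blocks. card (stabilizer G set_action B))"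
  proof (rule sum.cong)
    fix b assume "b \<in> ?blocks"
    then obtain g where "g \<in> carrier G" "b = \<phi> g ` B" "T \<subseteq> b" by (auto simp: orbit_def)
    moreover from this have "{h \<in> ?S. \<phi> h ` B = b} = {h \<in> carrier G. \<phi> h ` B = \<phi> g ` B}" by blast
    ultimately show "(\<Sum>g\<in>{g \<in> ?S. \<phi> g ` B = b}. 1) = card (stabilizer G set_action B)"
      using assms(2) by (simp add: card_set_action_fibre)
  qed simp
  finally show ?thesis by simp
qed

end

locale sharply_transitive_action = group_action +
  fixes t :: nat
  assumes sharply_transitive:
    "\<lbrakk>xs \<in> arrangements t E; ys \<in> arrangements t E\<rbrakk>
      \<Longrightarrow> \<exists>!g. g \<in> carrier G \<and> map (\<phi> g) xs = ys"

lemma (in group_action) sharply_transitive_actionI: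
  assumes base: "zs \<in> arrangements t E"
    and transitive: "\<And>xs. xs \<in> arrangements t E \<Longrightarrow> \<exists>g \<in> carrier G. map (\<phi> g) xs = zs"
    and free: "\<And>g. \<lbrakk>g \<in> carrier G; map (\<phi> g) zs = zs\<rbrakk> \<Longrightarrow> g = \<one>"
  shows "sharply_transitive_action G E \<phi> t"
proof
  interpret group G using group_hom by (rule group_hom.axioms(1))
  have map_mult: "map (\<phi> (g \<otimes> h)) xs = map (\<phi> g) (map (\<phi> h) xs)"
    if "xs \<in> arrangements t E" "g \<in> carrier G" "h \<in> carrier G" for xs g h
    using that composition_rule by (auto simp: arrangements_def)
  have map_inv: "map (\<phi> (inv g)) ys = xs"
    if "xs \<in> arrangements t E" "g \<in> carrier G" "map (\<phi> g) xs = ys" for xs ys g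
    using that by (auto simp: arrangements_def subset_iff inv_action intro!: map_idI)
  fix xs ys assume xs: "xs \<in> arrangements t E" and ys: "ys \<in> arrangements t E"
  obtain f where f: "f \<in> carrier G" "map (\<phi> f) xs = zs" using transitive[OF xs] by blast
  obtain e where e: "e \<in> carrier G" "map (\<phi> e) ys = zs" using transitive[OF ys] by blast
  show "\<exists>!g. g \<in> carrier G \<and> map (\<phi> g) xs = ys"
  proof (rule ex1I[of _ "inv e \<otimes> f"])
    show "inv e \<otimes> f \<in> carrier G \<and> map (\<phi> (inv e \<otimes> f)) xs = ys"
      using map_mult[OF xs, of "inv e" f] map_inv[OF ys e] e(1) f by simp
  next
    fix g assume g: "g \<in> carrier G \<and> map (\<phi> g) xs = ys"
    have "map (\<phi> (e \<otimes> g \<otimes> inv f)) zs = map (\<phi> (e \<otimes> g)) xs"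
      using map_mult[OF base, of "e \<otimes> g" "inv f"] map_inv[OF xs f] e(1) f(1) g by simp
    also have "\<dots> = zs" using map_mult[OF xs, of e g] e g by simp
    finally have "e \<otimes> g \<otimes> inv f = \<one>" using e(1) f(1) g by (intro free) simp_all
    then have "e \<otimes> g = f" using e(1) f(1) g by (metis inv_closed inv_equality inv_inv m_closed)
    then show "g = inv e \<otimes> f" using e(1) g by (auto simp: m_assoc[symmetric])
  qed
qed

context sharply_transitive_action
begin

lemma card_mapping_into:
  assumes "T \<subseteq> E" "finite T" "card T = t" "B \<subseteq> E"
  shows "card {g \<in> carrier G. \<phi> g ` T \<subseteq> B} = card (arrangements t B)"
proof -
  obtain ts where ts: "set ts = T" "distinct ts" using finite_distinct_list[OF assms(2)] by blast
  then have len: "length ts = t" using assms(3) by (metis distinct_card)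
  then have ts_arr: "ts \<in> arrangements t E" using ts assms(1) by (simp add: arrangements_def)
  have map_arr: "map (\<phi> g) ts \<in> arrangements t B \<longleftrightarrow> \<phi> g ` T \<subseteq> B" if "g \<in> carrier G" for g
  proof -
    have "inj_on (\<phi> g) T" using inj_prop[OF that] assms(1) by (rule inj_on_subset)
    then show ?thesis using ts len by (simp add: arrangements_def distinct_map)
  qed
  have arr_mono: "arrangements t B \<subseteq> arrangements t E" using assms(4) by (auto simp: arrangements_def)
  have "bij_betw (\<lambda>g. map (\<phi> g) ts) {g \<in> carrier G. \<phi> g ` T \<subseteq> B} (arrangements t B)"
  proof (rule bij_betwI')
    fix g h assume gh: "g \<in> {g \<in> carrier G. \<phi> g ` T \<subseteq> B}" "h \<in> {g \<in> carrier G. \<phi> g ` T \<subseteq> B}"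
    then have "map (\<phi> h) ts \<in> arrangements t E" using map_arr[of h] arr_mono by auto
    from sharply_transitive[OF ts_arr this] gh
    show "map (\<phi> g) ts = map (\<phi> h) ts \<longleftrightarrow> g = h" by auto
  next
    fix ys assume ys: "ys \<in> arrangements t B"
    then obtain g where "g \<in> carrier G" "map (\<phi> g) ts = ys"
      using sharply_transitive[OF ts_arr, of ys] arr_mono by auto
    then show "\<exists>g \<in> {g \<in> carrier G. \<phi> g ` T \<subseteq> B}. ys = map (\<phi> g) ts"
      using map_arr[of g] ys by auto
  qed (simp add: map_arr)
  then show ?thesis by (rule bij_betw_same_card)
qed

lemma card_stabilizer_if_rigid:
  assumes "B \<subseteq> E" "T \<subseteq> B" "finite T" "card T = t"
    and rigid: "\<And>g. \<lbrakk>g \<in> carrier G; \<phi> g ` T \<subseteq> B\<rbrakk> \<Longrightarrow> \<phi> g ` B = B"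
  shows "card (stabilizer G set_action B) = card (arrangements t B)"
proof -
  have "stabilizer G set_action B = {g \<in> carrier G. \<phi> g ` T \<subseteq> B}"
    using rigid assms(2) by (auto simp: stabilizer_def)
  then show ?thesis using card_mapping_into[of T B] assms by simp
qed

lemma is_3_design_orbit:
  assumes t: "t = 3" and fin: "finite (carrier G)" "finite E" and B: "B \<subseteq> E" "card B \<ge> 3"
    and count: "l * card (stabilizer G set_action B) = card B * (card B - 1) * (card B - 2)"
  shows "is_3_design (card E) (card B) l E (mset_set (orbit G set_action B))"
proof -
  let ?blocks = "\<lambda>T. {b \<in> orbit G set_action B. T \<subseteq> b}"
  have "card (?blocks T) = l" if T: "T \<subseteq> E" "card T = 3" for T
  proof -
    have "card (?blocks T) * card (stabilizer G set_action B)
        = card {g \<in> carrier G. \<phi> g ` T \<subseteq> B}"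
      using fin(1) B(1) T(1) by (rule card_blocks_times_card_stabilizer)
    also have "\<dots> = card (arrangements 3 B)"
      using card_mapping_into[of T B] T B(1) t fin(2) finite_subset by blast
    also have "\<dots> = l * card (stabilizer G set_action B)"
      using B(2) count by (simp add: card_arrangements_3)
    moreover have "card (stabilizer G set_action B) \<noteq> 0"
      using count B(2) by (intro notI) simp
    ultimately show ?thesis by simp
  qed
  moreover have "finite (orbit G set_action B)" using fin(1) by (simp add: orbit_def)
  moreover have "b \<subseteq> E \<and> card b = card B" if "b \<in> orbit G set_action B" for b
    using that card_set_action[OF B(1)] set_action_subset[OF B(1)] unfolding orbit_def by blast
  ultimately show ?thesis using fin(2) by (simp add: is_3_design_def filter_mset_mset_set)
qed

end

lemma simple_design_mset_set: "simple_design (mset_set A)"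
  by (simp add: simple_design_def count_mset_set')

section \<open>The projective linear group\<close>

text \<open>In homogeneous coordinates composition becomes the matrix product, without case distinctions at
  \<open>\<infinity>\<close>. The pair \<open>(0, 0)\<close> gives the junk value \<open>\<infinity>\<close>.\<close>

definition proj_point :: "'a::field \<Rightarrow> 'a \<Rightarrow> 'a option" where
  "proj_point x y = (if y = 0 then None else Some (x / y))"

lemma proj_point_cases:
  obtains x y :: "'a::field" where "z = proj_point x y" "x \<noteq> 0 \<or> y \<noteq> 0"
proof (cases z)
  case None
  then show ?thesis using that[of 1 0] by (simp add: proj_point_def)
next
  case (Some u)
  then show ?thesis using that[of u 1] by (simp add: proj_point_def)
qed

lemma linear_fractional_proj_point:
  fixes a b c d x y :: "'a::field"
  assumes "x \<noteq> 0 \<or> y \<noteq> 0"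
  shows "linear_fractional a b c d (proj_point x y) = proj_point (a * x + b * y) (c * x + d * y)"
proof (cases "y = 0")
  case True
  then show ?thesis using assms by (simp add: proj_point_def)
next
  case False
  have "c * (x / y) + d = (c * x + d * y) / y" "a * (x / y) + b = (a * x + b * y) / y"
    using False by (simp_all add: field_simps)
  then show ?thesis using False by (simp add: proj_point_def)
qed

lemma linear_map_nonzero:
  fixes a b c d x y :: "'a::field"
  assumes "a * d - b * c \<noteq> 0" "x \<noteq> 0 \<or> y \<noteq> 0"
  shows "a * x + b * y \<noteq> 0 \<or> c * x + d * y \<noteq> 0"
proof (rule ccontr)
  assume "\<not> ?thesis"
  then have "a * x + b * y = 0" "c * x + d * y = 0" by auto
  moreover have "(a * d - b * c) * x = d * (a * x + b * y) - b * (c * x + d * y)"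
    "(a * d - b * c) * y = a * (c * x + d * y) - c * (a * x + b * y)"
    by (simp_all add: algebra_simps)
  ultimately show False using assms by simp
qed

lemma linear_fractional_comp:
  fixes a b c d a' b' c' d' :: "'a::field"
  assumes "a' * d' - b' * c' \<noteq> 0"
  shows "linear_fractional a b c d \<circ> linear_fractional a' b' c' d' =
    linear_fractional (a * a' + b * c') (a * b' + b * d') (c * a' + d * c') (c * b' + d * d')"
proof
  fix z :: "'a option"
  obtain x y where z: "z = proj_point x y" "x \<noteq> 0 \<or> y \<noteq> 0" by (rule proj_point_cases)
  show "(linear_fractional a b c d \<circ> linear_fractional a' b' c' d') z =
    linear_fractional (a * a' + b * c') (a * b' + b * d') (c * a' + d * c') (c * b' + d * d') z"
    using linear_map_nonzero[OF assms z(2)] z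
    by (simp add: linear_fractional_proj_point algebra_simps)
qed

lemma linear_fractional_mult_cancel:
  fixes a b c d e :: "'a::field"
  assumes "e \<noteq> 0"
  shows "linear_fractional (e * a) (e * b) (e * c) (e * d) = linear_fractional a b c d"
proof
  fix z :: "'a option"
  have "e * x * y + e * w = e * (x * y + w)" for x y w by (simp add: algebra_simps)
  then show "linear_fractional (e * a) (e * b) (e * c) (e * d) z = linear_fractional a b c d z"
    using assms by (cases z) simp_all
qed

lemma linear_fractional_scalar:
  fixes a :: "'a::field"
  assumes "a \<noteq> 0"
  shows "linear_fractional a 0 0 a = id"
proof
  fix z :: "'a option"
  show "linear_fractional a 0 0 a z = id z" using assms by (cases z) simp_all
qed

lemma mult_PGL2 [simp]: "g \<otimes>\<^bsub>PGL2\<^esub> h = g \<circ> h"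
  by (simp add: PGL2_def)

lemma one_PGL2 [simp]: "\<one>\<^bsub>PGL2\<^esub> = id"
  by (simp add: PGL2_def)

lemma linear_fractional_in_PGL2:
  "a * d - b * c \<noteq> 0 \<Longrightarrow> linear_fractional a b c d \<in> carrier PGL2"
  unfolding PGL2_def by auto

lemma carrier_PGL2E:
  assumes "g \<in> carrier PGL2"
  obtains a b c d where "g = linear_fractional a b c d" "a * d - b * c \<noteq> 0"
  using assms unfolding PGL2_def by auto

lemma group_PGL2: "group (PGL2 :: ('a::field option \<Rightarrow> 'a option) monoid)"
proof (rule groupI)
  fix g h :: "'a option \<Rightarrow> 'a option"
  assume "g \<in> carrier PGL2" "h \<in> carrier PGL2"
  then obtain a b c d a' b' c' d'
    where g: "g = linear_fractional a b c d" "a * d - b * c \<noteq> 0"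
      and h: "h = linear_fractional a' b' c' d'" "a' * d' - b' * c' \<noteq> 0"
    by (elim carrier_PGL2E)
  have "(a * a' + b * c') * (c * b' + d * d') - (a * b' + b * d') * (c * a' + d * c')
      = (a * d - b * c) * (a' * d' - b' * c')"
    by (simp add: algebra_simps)
  then show "g \<otimes>\<^bsub>PGL2\<^esub> h \<in> carrier PGL2"
    using g h by (simp add: linear_fractional_comp linear_fractional_in_PGL2)
next
  show "\<one>\<^bsub>PGL2\<^esub> \<in> carrier (PGL2 :: ('a option \<Rightarrow> 'a option) monoid)"
    using linear_fractional_in_PGL2[of 1 1 0 "0::'a"] by (simp add: linear_fractional_scalar)
next
  fix g :: "'a option \<Rightarrow> 'a option"
  assume "g \<in> carrier PGL2"
  then obtain a b c d where g: "g = linear_fractional a b c d" "a * d - b * c \<noteq> 0"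
    by (rule carrier_PGL2E)
  have "linear_fractional d (- b) (- c) a \<otimes>\<^bsub>PGL2\<^esub> g = \<one>\<^bsub>PGL2\<^esub>"
    using g linear_fractional_scalar[OF g(2)] by (simp add: linear_fractional_comp algebra_simps)
  moreover have "linear_fractional d (- b) (- c) a \<in> carrier PGL2"
    using g(2) by (intro linear_fractional_in_PGL2) (simp add: algebra_simps)
  ultimately show "\<exists>h \<in> carrier PGL2. h \<otimes>\<^bsub>PGL2\<^esub> g = \<one>\<^bsub>PGL2\<^esub>" by blast
qed (simp_all add: comp_assoc)

lemma bij_PGL2:
  assumes "g \<in> carrier PGL2"
  shows "bij g"
proof -
  interpret group PGL2 by (rule group_PGL2)
  show ?thesis using l_inv[OF assms] r_inv[OF assms] by (intro o_bij) simp_all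
qed

lemma group_action_PGL2: "group_action PGL2 UNIV (\<lambda>g. g)"
  unfolding group_action_def group_hom_def group_hom_axioms_def
proof (intro conjI group_PGL2 group_BijGroup)
  show "(\<lambda>g. g) \<in> hom PGL2 (BijGroup UNIV)"
    by (auto simp: hom_def BijGroup_def Bij_def bij_PGL2 compose_def comp_def)
qed

lemma PGL2_to_standard_triple:
  fixes x y z :: "'a::field option"
  assumes "distinct [x, y, z]"
  shows "\<exists>g \<in> carrier PGL2. map g [x, y, z] = [None, Some 0, Some 1]"
proof -
  obtain f where f: "f \<in> carrier PGL2" "f x = None"
  proof (cases x)
    case None
    then show ?thesis
      using that[OF linear_fractional_in_PGL2[of 1 1 0 0]] by simp
  next
    case (Some u)
    then show ?thesis
      using that[OF linear_fractional_in_PGL2[of 0 "- u" 1 1]] by simp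
  qed
  have "inj f" using bij_PGL2[OF f(1)] by (rule bij_is_inj)
  then have "f y \<noteq> f x" "f z \<noteq> f x" "f y \<noteq> f z"
    using assms by (auto dest: injD)
  then obtain u v where uv: "f y = Some u" "f z = Some v" "u \<noteq> v"
    using f(2) by (metis option.exhaust)
  let ?h = "linear_fractional 1 (- u) 0 (v - u)"
  have "?h \<in> carrier PGL2" using uv(3) by (intro linear_fractional_in_PGL2) simp
  with f(1) have "?h \<circ> f \<in> carrier PGL2"
    using group.is_monoid[OF group_PGL2] monoid.m_closed by fastforce
  moreover have "map (?h \<circ> f) [x, y, z] = [None, Some 0, Some 1]" using uv f(2) by simp
  ultimately show ?thesis by (intro bexI[of _ "?h \<circ> f"])
qed

lemma PGL2_fixing_standard_triple:
  assumes "g \<in> carrier PGL2" "map g [None, Some 0, Some 1] = [None, Some 0, Some 1]"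
  shows "g = id"
proof -
  obtain a b c d where g: "g = linear_fractional a b c d" "a * d - b * c \<noteq> 0"
    using assms(1) by (rule carrier_PGL2E)
  have "c = 0" using assms(2) by (auto simp: g split: if_splits)
  moreover from this have "d \<noteq> 0" "a \<noteq> 0" using g(2) by auto
  moreover from calculation have "b = 0" "a = d" using assms(2) by (auto simp: g)
  ultimately show ?thesis using linear_fractional_scalar[of a] by (simp add: g)
qed

theorem sharply_3_transitive_PGL2:
  "sharply_transitive_action (PGL2 :: ('a::field option \<Rightarrow> 'a option) monoid) UNIV (\<lambda>g. g) 3"
proof (rule group_action.sharply_transitive_actionI[OF group_action_PGL2])
  let ?zs = "[None, Some 0, Some 1 :: 'a option]"
  show "?zs \<in> arrangements 3 UNIV" by (simp add: arrangements_def)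
  show "\<exists>g \<in> carrier PGL2. map g xs = ?zs" if "xs \<in> arrangements 3 UNIV" for xs
    using that PGL2_to_standard_triple by (metis arrangements_3E)
  show "g = \<one>\<^bsub>PGL2\<^esub>" if "g \<in> carrier PGL2" "map g ?zs = ?zs" for g
    using PGL2_fixing_standard_triple[OF that] by simp
qed

section \<open>The stabilizer of the group of roots of unity\<close>

definition roots_of_unity :: "nat \<Rightarrow> 'a::idom set" where
  "roots_of_unity k = {u. u ^ k = 1}"

lemma
  fixes c :: "'a::idom"
  assumes "n > 0"
  shows finite_nth_roots: "finite {x. x ^ n = c}"
    and card_nth_roots_le: "card {x. x ^ n = c} \<le> n"
proof -
  let ?P = "Polynomial.monom 1 n - [:c:]"
  have "poly.coeff ?P n = 1" using assms by (cases n) auto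
  then have "?P \<noteq> 0" by (metis coeff_0 zero_neq_one)
  then have "finite {x. poly ?P x = 0}" "card {x. poly ?P x = 0} \<le> degree ?P"
    by (rule poly_roots_finite, rule card_poly_roots_bound)
  moreover have "degree ?P \<le> n" by (intro degree_diff_le degree_monom_le) simp
  moreover have "{x. poly ?P x = 0} = {x. x ^ n = c}" by (simp add: poly_monom)
  ultimately show "finite {x. x ^ n = c}" "card {x. x ^ n = c} \<le> n" by auto
qed

lemma finite_roots_of_unity: "k > 0 \<Longrightarrow> finite (roots_of_unity k)"
  unfolding roots_of_unity_def by (rule finite_nth_roots)

lemma roots_of_unity_nonzero: "\<lbrakk>k > 0; u \<in> roots_of_unity k\<rbrakk> \<Longrightarrow> u \<noteq> 0"
  by (auto simp: roots_of_unity_def power_0_left)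

lemma linear_fractional_root_of_unity_iff:
  fixes a b c d x :: "'a::field"
  assumes "a * d - b * c \<noteq> 0" "k > 0"
  shows "linear_fractional a b c d (Some x) \<in> Some ` roots_of_unity k
    \<longleftrightarrow> (a * x + b) ^ k = (c * x + d) ^ k"
proof (cases "c * x + d = 0")
  case True
  then have "a * x + b \<noteq> 0" using linear_map_nonzero[OF assms(1), of x 1] by simp
  then show ?thesis using True assms(2) by (auto simp: power_0_left)
next
  case False
  then show ?thesis by (auto simp: roots_of_unity_def power_divide)
qed

lemma mem_stabilizer_roots_of_unity_iff:
  fixes g :: "'a::field option \<Rightarrow> 'a option"
  assumes "k > 0" "g \<in> carrier PGL2"
  shows "g \<in> stabilizer PGL2 (\<lambda>g. (`) g) (Some ` roots_of_unity k)
    \<longleftrightarrow> g ` Some ` roots_of_unity k \<subseteq> Some ` roots_of_unity k"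
  using assms by (intro group_action.mem_stabilizer_set_action_iff[OF group_action_PGL2])
    (simp_all add: finite_roots_of_unity)

lemma power_CHAR_power_diff:
  fixes x y :: "'a::comm_ring_1"
  assumes "prime CHAR('a)"
  shows "(x - y) ^ (CHAR('a) ^ m) = x ^ (CHAR('a) ^ m) - y ^ (CHAR('a) ^ m)"
  using freshmans_dream'[OF assms refl, of "x - y" y m] by simp

lemma power_CHAR_power_eq_iff:
  fixes x y :: "'a::idom"
  assumes "prime CHAR('a)"
  shows "x ^ (CHAR('a) ^ m) = y ^ (CHAR('a) ^ m) \<longleftrightarrow> x = y"
  using power_CHAR_power_diff[OF assms, of x y m] by auto

subsection \<open>Exponents one more than a power of the characteristic\<close>

lemma linear_power_root_of_unity_quadratic:
  fixes e f x :: "'a::idom"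
  assumes "prime CHAR('a)" and s: "s = CHAR('a) ^ m" and x: "x ^ (s + 1) = 1"
  shows "x * (e * x + f) ^ (s + 1)
    = e ^ s * f + (e ^ s * e + f ^ s * f) * x + f ^ s * e * x\<^sup>2"
proof -
  have "x * (e * x + f) ^ (s + 1) = x * (e * x + f) ^ s * (e * x + f)" by simp
  also have "(e * x + f) ^ s = e ^ s * x ^ s + f ^ s"
    using assms(1) s by (simp add: freshmans_dream' power_mult_distrib)
  also have "x * (e ^ s * x ^ s + f ^ s) = e ^ s * x ^ (s + 1) + f ^ s * x"
    by (simp add: algebra_simps)
  also have "(e ^ s * x ^ (s + 1) + f ^ s * x) * (e * x + f)
      = e ^ s * f + (e ^ s * e + f ^ s * f) * x + f ^ s * e * x\<^sup>2"
    unfolding x by (simp add: algebra_simps power2_eq_square)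
  finally show ?thesis .
qed

lemma PGL2_roots_of_unity_rigid:
  fixes g :: "'a::field option \<Rightarrow> 'a option"
  assumes char: "prime CHAR('a)" and k: "k = CHAR('a) ^ m + 1" and g: "g \<in> carrier PGL2"
    and T: "T \<subseteq> roots_of_unity k" "card T \<ge> 3" "g ` Some ` T \<subseteq> Some ` roots_of_unity k"
  shows "g ` Some ` roots_of_unity k \<subseteq> Some ` roots_of_unity k"
proof -
  obtain a b c d where abcd: "g = linear_fractional a b c d" "a * d - b * c \<noteq> 0"
    using g by (rule carrier_PGL2E)
  define s where "s = CHAR('a) ^ m"
  define Q where "Q = [:a ^ s * b - c ^ s * d, a ^ s * a + b ^ s * b - c ^ s * c - d ^ s * d,
    b ^ s * a - d ^ s * c:]"
  have iff: "g (Some x) \<in> Some ` roots_of_unity k \<longleftrightarrow> poly Q x = 0" if x: "x \<in> roots_of_unity k" for x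
  proof -
    have "poly Q x = x * (a * x + b) ^ k - x * (c * x + d) ^ k"
      using x linear_power_root_of_unity_quadratic[OF char s_def, of x]
      by (simp add: k s_def[symmetric] roots_of_unity_def Q_def algebra_simps power2_eq_square
          del: power_Suc)
    moreover have "x \<noteq> 0" using x k by (intro roots_of_unity_nonzero) auto
    ultimately show ?thesis
      using linear_fractional_root_of_unity_iff[OF abcd(2), of k x] k
      by (simp add: abcd(1) flip: right_diff_distrib)
  qed
  have "Q = 0"
  proof (rule ccontr)
    assume "Q \<noteq> 0"
    have "T \<subseteq> {x. poly Q x = 0}" using T(1,3) iff by blast
    then have "card T \<le> card {x. poly Q x = 0}"
      using \<open>Q \<noteq> 0\<close> by (intro card_mono poly_roots_finite)
    also have "\<dots> \<le> degree Q" using \<open>Q \<noteq> 0\<close> by (rule card_poly_roots_bound)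
    also have "\<dots> \<le> 2" by (simp add: Q_def)
    finally show False using T(2) by simp
  qed
  then show ?thesis using iff by auto
qed

theorem card_stabilizer_roots_of_unity_char_power:
  assumes char: "prime CHAR('a::field)" and k: "k = CHAR('a) ^ m + 1"
    and card: "card (roots_of_unity k :: 'a set) = k" and "k \<ge> 3"
  shows "card (stabilizer PGL2 (\<lambda>g. (`) g) (Some ` (roots_of_unity k :: 'a set)))
    = k * (k - 1) * (k - 2)"
proof -
  interpret sharply_transitive_action "PGL2 :: ('a option \<Rightarrow> 'a option) monoid" UNIV "\<lambda>g. g" 3
    by (rule sharply_3_transitive_PGL2)
  let ?B = "Some ` (roots_of_unity k :: 'a set)"
  obtain T :: "'a set" where T: "T \<subseteq> roots_of_unity k" "card T = 3"
    using \<open>k \<ge> 3\<close> card by (metis obtain_subset_with_card_n)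
  have "card (stabilizer PGL2 (\<lambda>g. (`) g) ?B) = card (arrangements 3 ?B)"
  proof (rule card_stabilizer_if_rigid[where T = "Some ` T"])
    show "finite (Some ` T)" "card (Some ` T) = 3"
      using T(2) by (auto simp: card_image intro: card_ge_0_finite)
    fix g :: "'a option \<Rightarrow> 'a option" assume g: "g \<in> carrier PGL2" "g ` Some ` T \<subseteq> ?B"
    then have "g ` ?B \<subseteq> ?B" using T by (intro PGL2_roots_of_unity_rigid[OF char k]) simp_all
    then show "g ` ?B = ?B"
      using mem_stabilizer_roots_of_unity_iff[of k g] g(1) k by (simp add: stabilizer_def)
  qed (use T(1) in auto)
  then show ?thesis using card \<open>k \<ge> 3\<close> by (simp add: card_arrangements_3 card_image)
qed

subsection \<open>Other exponents\<close>

lemma coeff_eq_0_if_zero_on_roots_of_unity: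
  fixes P :: "'a::idom poly"
  assumes card: "card (roots_of_unity k :: 'a set) = k" and deg: "degree P \<le> k"
    and zero: "\<And>u. u \<in> roots_of_unity k \<Longrightarrow> poly P u = 0" and i: "0 < i" "i < k"
  shows "poly.coeff P i = 0"
proof -
  let ?R = "Polynomial.smult (poly.coeff P k) (Polynomial.monom 1 k - 1)"
  have "P = ?R"
  proof (rule poly_eqI_degree_lead_coeff[where n = k and A = "roots_of_unity k"])
    show "poly.coeff P k = poly.coeff ?R k" using i by (simp add: coeff_eq_0)
    show "degree ?R \<le> k"
      by (intro order.trans[OF degree_smult_le] degree_diff_le degree_monom_le) simp
    show "poly P u = poly ?R u" if "u \<in> roots_of_unity k" for u
      using that zero[OF that] by (simp add: roots_of_unity_def poly_monom)
  qed (simp_all add: card deg)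
  then have "poly.coeff P i = poly.coeff ?R i" by simp
  also have "\<dots> = 0" using i by (simp add: coeff_eq_0)
  finally show ?thesis .
qed

lemma linear_fractional_into_roots_of_unity_coeff:
  fixes a b c d :: "'a::field"
  assumes det: "a * d - b * c \<noteq> 0" and card: "card (roots_of_unity k :: 'a set) = k"
    and into: "linear_fractional a b c d ` Some ` roots_of_unity k \<subseteq> Some ` roots_of_unity k"
    and i: "0 < i" "i < k" "\<not> CHAR('a) dvd (k choose i)"
  shows "a ^ i * b ^ (k - i) = c ^ i * d ^ (k - i)"
proof -
  let ?P = "[:b, a:] ^ k - [:d, c:] ^ k"
  have "poly.coeff ?P i = 0"
  proof (rule coeff_eq_0_if_zero_on_roots_of_unity[OF card])
    have "degree ([:v, u:] ^ k) \<le> k" for u v :: 'a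
      using degree_power_le[of "[:v, u:]" k] by (simp split: if_splits)
    then show "degree ?P \<le> k" by (intro degree_diff_le)
    show "poly ?P x = 0" if "x \<in> roots_of_unity k" for x
    proof -
      have "linear_fractional a b c d (Some x) \<in> Some ` roots_of_unity k" using that into by blast
      then show ?thesis
        using linear_fractional_root_of_unity_iff[OF det, of k x] i by (simp add: algebra_simps)
    qed
  qed (use i in auto)
  then have "of_nat (k choose i) * (a ^ i * b ^ (k - i)) = of_nat (k choose i) * (c ^ i * d ^ (k - i))"
    using i(2) by (simp add: coeff_linear_poly_power algebra_simps)
  then show ?thesis using i(3) by (simp add: of_nat_eq_0_iff_char_dvd)
qed

lemma not_dvd_Suc_choose_Suc_prime_power:
  fixes p m t :: nat
  assumes "prime p" "\<not> p dvd t" "\<not> p dvd p ^ m * t + 1"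
  shows "\<not> p dvd (p ^ m * t + 1 choose (p ^ m + 1))"
proof
  assume "p dvd (p ^ m * t + 1 choose (p ^ m + 1))"
  then have "p dvd (p ^ m + 1) * (p ^ m * t + 1 choose (p ^ m + 1))" by (rule dvd_mult)
  also have "\<dots> = (p ^ m * t + 1) * (p ^ m * t choose p ^ m)"
    using Suc_times_binomial[of "p ^ m" "p ^ m * t"] by simp
  finally have "p dvd (p ^ m * t choose p ^ m)"
    using assms(1,3) prime_dvd_multD by blast
  moreover have "t > 0" using assms(2) by (intro gr0I) simp
  then have "multiplicity p (p ^ m * t choose p ^ m) = 0"
    using const_p_fac[of t p m] assms(1,2) by (simp add: not_dvd_imp_multiplicity_0)
  moreover have "(p ^ m * t choose p ^ m) \<noteq> 0" using \<open>t > 0\<close> by simp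
  ultimately show False using assms(1) by (simp add: prime_elem_multiplicity_eq_zero_iff)
qed

lemma linear_fractional_into_roots_of_unity_cases:
  fixes a b c d :: "'a::field"
  assumes char: "prime CHAR('a)" and k: "k = CHAR('a) ^ m * t + 1" "t \<ge> 2"
    "\<not> CHAR('a) dvd t" "\<not> CHAR('a) dvd k"
    and card: "card (roots_of_unity k :: 'a set) = k" and det: "a * d - b * c \<noteq> 0"
    and into: "linear_fractional a b c d ` Some ` roots_of_unity k \<subseteq> Some ` roots_of_unity k"
  shows "b = 0 \<and> c = 0 \<or> a = 0 \<and> d = 0"
proof -
  define s where "s = CHAR('a) ^ m"
  define e where "e = k - (s + 1)"
  note coeff = linear_fractional_into_roots_of_unity_coeff[OF det card into]
  have "s > 0" using char by (simp add: s_def prime_gt_0_nat)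
  then have "s * 1 < s * t" using k(2) by (intro mult_strict_left_mono) auto
  then have "s + 1 < k" using k(1) by (simp add: s_def)
  then have e: "k - (s + 1) = e" "k - 1 = s + e" by (simp_all add: e_def)
  have linear: "a * b ^ (s + e) = c * d ^ (s + e)"
    using coeff[of 1] k(4) \<open>s + 1 < k\<close> by (simp flip: e(2))
  have "\<not> CHAR('a) dvd (k choose (s + 1))"
    using not_dvd_Suc_choose_Suc_prime_power[OF char k(3)] k(4) unfolding k(1) s_def by blast
  then have high: "a ^ (s + 1) * b ^ e = c ^ (s + 1) * d ^ e"
    using coeff[of "s + 1"] \<open>s + 1 < k\<close> unfolding e(1) by simp
  show ?thesis
  proof (cases "a = 0 \<or> b = 0 \<or> c = 0 \<or> d = 0")
    case True
    then show ?thesis using linear det \<open>s > 0\<close> by (auto simp: power_0_left)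
  next
    case False
    have "(a * d) ^ s * (a * c * b ^ e * d ^ e) = (a ^ (s + 1) * b ^ e) * (c * d ^ (s + e))"
      by (simp add: power_mult_distrib power_add)
    also have "\<dots> = (b * c) ^ s * (a * c * b ^ e * d ^ e)"
      unfolding high linear[symmetric] by (simp add: power_mult_distrib power_add)
    finally have "(a * d) ^ s = (b * c) ^ s" using False by simp
    then have "a * d = b * c" unfolding s_def by (simp only: power_CHAR_power_eq_iff[OF char])
    then show ?thesis using det by simp
  qed
qed

definition dihedral_maps :: "'a::field set \<Rightarrow> ('a option \<Rightarrow> 'a option) set" where
  "dihedral_maps U = (\<lambda>u. linear_fractional u 0 0 1) ` U \<union> (\<lambda>u. linear_fractional 0 u 1 0) ` U"

lemma card_dihedral_maps:
  assumes "finite U"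
  shows "card (dihedral_maps U) = 2 * card U"
proof -
  have "inj_on (\<lambda>u. linear_fractional u 0 0 1) U" "inj_on (\<lambda>u. linear_fractional 0 u 1 0) U"
    by (auto intro!: inj_onI dest!: fun_cong[where x = "Some 1"])
  moreover have "linear_fractional u 0 0 1 \<noteq> linear_fractional 0 v 1 0" for u v :: 'a
    by (auto dest!: fun_cong[where x = None])
  ultimately show ?thesis
    using assms unfolding dihedral_maps_def by (subst card_Un_disjoint) (auto simp: card_image)
qed

lemma dihedral_maps_subset_stabilizer:
  assumes "k > 0"
  shows "dihedral_maps (roots_of_unity k :: 'a::field set)
    \<subseteq> stabilizer PGL2 (\<lambda>g. (`) g) (Some ` roots_of_unity k)"
proof
  let ?U = "roots_of_unity k :: 'a set"
  fix g assume g: "g \<in> dihedral_maps ?U"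
  have nonzero: "u \<noteq> 0" if "u \<in> ?U" for u using assms that by (rule roots_of_unity_nonzero)
  have "g \<in> carrier PGL2"
    using g nonzero by (auto simp: dihedral_maps_def intro!: linear_fractional_in_PGL2)
  moreover have "g ` Some ` ?U \<subseteq> Some ` ?U"
    using g nonzero
    by (auto simp: dihedral_maps_def roots_of_unity_def power_mult_distrib power_divide)
  ultimately show "g \<in> stabilizer PGL2 (\<lambda>g. (`) g) (Some ` ?U)"
    using assms by (simp add: mem_stabilizer_roots_of_unity_iff)
qed

lemma stabilizer_roots_of_unity_eq_dihedral_maps:
  assumes char: "prime CHAR('a::field)" and k: "k = CHAR('a) ^ m * t + 1" "t \<ge> 2"
    "\<not> CHAR('a) dvd t" "\<not> CHAR('a) dvd k"
    and card: "card (roots_of_unity k :: 'a set) = k"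
  shows "stabilizer PGL2 (\<lambda>g. (`) g) (Some ` roots_of_unity k)
    = dihedral_maps (roots_of_unity k :: 'a set)"
proof (intro equalityI dihedral_maps_subset_stabilizer subsetI)
  let ?U = "roots_of_unity k :: 'a set"
  fix g :: "'a option \<Rightarrow> 'a option"
  assume "g \<in> stabilizer PGL2 (\<lambda>g. (`) g) (Some ` ?U)"
  then have g: "g \<in> carrier PGL2" "g ` Some ` ?U \<subseteq> Some ` ?U" by (simp_all add: stabilizer_def)
  obtain a b c d where abcd: "g = linear_fractional a b c d" "a * d - b * c \<noteq> 0"
    using g(1) by (rule carrier_PGL2E)
  have "1 \<in> ?U" by (simp add: roots_of_unity_def)
  then have image_one: "linear_fractional a b c d (Some 1) \<in> Some ` ?U" using g(2) abcd(1) by blast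
  from linear_fractional_into_roots_of_unity_cases[OF char k card abcd(2)] g(2)
  consider (diagonal) "b = 0" "c = 0" | (antidiagonal) "a = 0" "d = 0" by (auto simp: abcd(1))
  then show "g \<in> dihedral_maps ?U"
  proof cases
    case diagonal
    then have "d \<noteq> 0" using abcd(2) by auto
    then have "g = linear_fractional (a / d) 0 0 1" "a / d \<in> ?U"
      using linear_fractional_mult_cancel[of d "a / d" 0 0 1] image_one diagonal by (auto simp: abcd(1))
    then show ?thesis by (auto simp: dihedral_maps_def)
  next
    case antidiagonal
    then have "c \<noteq> 0" using abcd(2) by auto
    then have "g = linear_fractional 0 (b / c) 1 0" "b / c \<in> ?U"
      using linear_fractional_mult_cancel[of c 0 "b / c" 1 0] image_one antidiagonal
      by (auto simp: abcd(1))
    then show ?thesis by (auto simp: dihedral_maps_def)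
  qed
qed (use k(1) in simp)

theorem card_stabilizer_roots_of_unity_dihedral:
  assumes "prime CHAR('a::field)" "k = CHAR('a) ^ m * t + 1" "t \<ge> 2"
    "\<not> CHAR('a) dvd t" "\<not> CHAR('a) dvd k" "card (roots_of_unity k :: 'a set) = k"
  shows "card (stabilizer PGL2 (\<lambda>g. (`) g) (Some ` (roots_of_unity k :: 'a set))) = 2 * k"
  unfolding stabilizer_roots_of_unity_eq_dihedral_maps[OF assms]
  using assms(2,6) by (simp add: card_dihedral_maps finite_roots_of_unity)

section \<open>The orbit of a multiplicative subgroup\<close>

lemma power_CARD_minus_1:
  fixes x :: "'a::{field, finite}"
  assumes "x \<noteq> 0"
  shows "x ^ (CARD('a) - 1) = 1"
proof -
  have "(\<Prod>y\<in>UNIV - {0}. x * y) = \<Prod>(UNIV - {0})"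
    by (rule prod.reindex_bij_witness[of _ "\<lambda>y. y / x" "\<lambda>y. x * y"]) (use assms in auto)
  moreover have "(\<Prod>y\<in>UNIV - {0}. x * y) = x ^ (CARD('a) - 1) * \<Prod>(UNIV - {0})"
    by (simp add: prod.distrib)
  moreover have "\<Prod>(UNIV - {0 :: 'a}) \<noteq> 0" by simp
  ultimately show ?thesis by simp
qed

lemma
  assumes card: "CARD('a::{field, finite}) - 1 = k * r" and pos: "k > 0" "r > 0"
  shows units_power_eq_roots_of_unity: "(\<lambda>x :: 'a. x ^ r) ` (UNIV - {0}) = roots_of_unity k"
    and card_roots_of_unity: "card (roots_of_unity k :: 'a set) = k"
proof -
  let ?C = "(\<lambda>x :: 'a. x ^ r) ` (UNIV - {0})" and ?U = "roots_of_unity k :: 'a set"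
  have sub: "?C \<subseteq> ?U"
    using power_CARD_minus_1[where 'a = 'a] card
    by (auto simp: roots_of_unity_def mult.commute simp flip: power_mult)
  have fibre: "card {x \<in> UNIV - {0}. x ^ r = c} \<le> r" for c :: 'a
  proof -
    have "card {x \<in> UNIV - {0}. x ^ r = c} \<le> card {x. x ^ r = c}" by (rule card_mono) auto
    also have "\<dots> \<le> r" using pos(2) by (rule card_nth_roots_le)
    finally show ?thesis .
  qed
  have "k * r = card (UNIV - {0 :: 'a})" using card by simp
  also have "\<dots> = (\<Sum>x\<in>UNIV - {0 :: 'a}. 1)" by simp
  also have "\<dots> = (\<Sum>c\<in>?C. \<Sum>x\<in>{x \<in> UNIV - {0}. x ^ r = c}. 1)"
    by (rule sum.group[symmetric]) auto
  also have "\<dots> \<le> (\<Sum>c\<in>?C. r)" using fibre by (intro sum_mono) simp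
  finally have "k \<le> card ?C" using pos(2) by simp
  moreover have "card ?C \<le> card ?U" using sub by (intro card_mono) auto
  moreover have "card ?U \<le> k"
    using pos(1) unfolding roots_of_unity_def by (rule card_nth_roots_le)
  ultimately have "card ?C = k" "card ?U = k" by auto
  then show "card ?U = k" "?C = ?U" using sub by (simp_all add: card_subset_eq)
qed

lemma cyclic_subgroup_power: "cyclic_subgroup (g ^ r) = (\<lambda>x. x ^ r) ` cyclic_subgroup g"
proof -
  have "(g ^ r) powi i = (g powi i) ^ r" for i
    by (metis mult.commute power_int_mult power_int_of_nat)
  then show ?thesis by (auto simp: cyclic_subgroup_def)
qed

lemma CHAR_eq_if_CARD_prime_power:
  assumes "prime p" "CARD('a::{field, finite}) = p ^ n"
  shows "CHAR('a) = p"
proof -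
  have "prime CHAR('a)" by (rule prime_CHAR_semidom) (simp add: finite_imp_CHAR_pos)
  moreover have "CHAR('a) dvd p ^ n" using CHAR_dvd_CARD[where 'a = 'a] assms(2) by simp
  ultimately show ?thesis using assms(1) prime_dvd_power primes_dvd_imp_eq by blast
qed

lemma not_dvd_prime_power_obtain:
  fixes p n j :: nat
  assumes "prime p" "0 < j" "j \<le> p ^ n" "\<not> j dvd p ^ n"
  obtains m t where "j = p ^ m * t" "t \<ge> 2" "\<not> p dvd t"
proof -
  have "\<not> is_unit p" using assms(1) not_prime_unit by blast
  then obtain t where t: "j = p ^ multiplicity p j * t" "\<not> p dvd t"
    using assms(2) multiplicity_decompose'[of j p] by blast
  have "t \<noteq> 1"
  proof
    assume "t = 1"
    then have "p ^ multiplicity p j \<le> p ^ n" using t(1) assms(3) by simp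
    then have "p ^ multiplicity p j dvd p ^ n"
      using assms(1) by (meson le_imp_power_dvd power_le_imp_le_exp prime_gt_1_nat)
    then show False using t(1) \<open>t = 1\<close> assms(4) by simp
  qed
  moreover have "t \<noteq> 0" using t(2) by (intro notI) simp
  ultimately have "t \<ge> 2" by simp
  then show ?thesis using that t by blast
qed

lemma CHAR_not_dvd_if_dvd_CARD_minus_1:
  assumes "k dvd CARD('a::{field, finite}) - 1"
  shows "\<not> CHAR('a) dvd k"
proof
  assume "CHAR('a) dvd k"
  then have "CHAR('a) dvd CARD('a) - 1" using assms by (rule dvd_trans)
  then have "CHAR('a) dvd CARD('a) - (CARD('a) - 1)" using CHAR_dvd_CARD by (rule dvd_diff_nat[rotated])
  then show False by simp
qed

lemma card_stabilizer_roots_of_unity: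
  assumes "prime p" "CARD('a::{field, finite}) = p ^ n"
    and k: "k \<ge> 3" "k dvd CARD('a) - 1" "card (roots_of_unity k :: 'a set) = k"
  shows "card (stabilizer PGL2 (\<lambda>g. (`) g) (Some ` (roots_of_unity k :: 'a set)))
    = (if k - 1 dvd p ^ n then k * (k - 1) * (k - 2) else 2 * k)"
proof -
  have char: "CHAR('a) = p" using assms(1,2) by (rule CHAR_eq_if_CARD_prime_power)
  then have prime: "prime CHAR('a)" using assms(1) by simp
  show ?thesis
  proof (cases "k - 1 dvd p ^ n")
    case True
    then obtain m where "k - 1 = p ^ m" using assms(1) divides_primepow_nat by blast
    then have "k = CHAR('a) ^ m + 1" using k(1) char by simp
    then show ?thesis
      using card_stabilizer_roots_of_unity_char_power[OF prime _ k(3,1)] True by simp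
  next
    case False
    have "k \<le> p ^ n"
      using card_mono[of UNIV "roots_of_unity k :: 'a set"] k(3) assms(2) by simp
    then have "0 < k - 1" "k - 1 \<le> p ^ n" using k(1) by simp_all
    then obtain m t where "k - 1 = p ^ m * t" and t: "t \<ge> 2" "\<not> p dvd t"
      using not_dvd_prime_power_obtain[OF assms(1) _ _ False] by blast
    then have k_eq: "k = CHAR('a) ^ m * t + 1" using k(1) char by simp
    show ?thesis
      using card_stabilizer_roots_of_unity_dihedral[OF prime k_eq t(1) _ _ k(3)]
        CHAR_not_dvd_if_dvd_CARD_minus_1[OF k(2)] t(2) False char by simp
  qed
qed

theorem theorem3:
  fixes p n q k r :: nat and \<theta> :: "'a::{field, finite}" and B :: "'a option set"
    and \<B> :: "'a option set multiset"
  assumes "prime p" and "q = p ^ n" and "CARD('a) = q"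
    and "primitive_element \<theta>"
    and "k \<ge> 4" and "r \<ge> 1" and "q - 1 = k * r"
    and "B = Some ` cyclic_subgroup (\<theta> ^ r)"
    and "\<B> = mset_set (orbit PGL2 (\<lambda>g. (`) g) B)"
  shows "is_3_design (q + 1) k (if k - 1 dvd q then 1 else (k - 1) * (k - 2) div 2) UNIV \<B>
         \<and> simple_design \<B>"
proof -
  let ?l = "if k - 1 dvd q then 1 else (k - 1) * (k - 2) div 2"
  have roots: "cyclic_subgroup (\<theta> ^ r) = roots_of_unity k"
    using assms(3-7) units_power_eq_roots_of_unity[where 'a = 'a, of k r]
    by (simp add: cyclic_subgroup_power primitive_element_def)
  have card_roots: "card (roots_of_unity k :: 'a set) = k"
    using assms(3,5-7) by (intro card_roots_of_unity[where r = r]) simp_all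
  then have card_B: "card B = k" by (simp add: assms(8) roots card_image)
  have card_stab: "card (stabilizer PGL2 (\<lambda>g. (`) g) B)
      = (if k - 1 dvd q then k * (k - 1) * (k - 2) else 2 * k)"
    using card_stabilizer_roots_of_unity[OF assms(1), where 'a = 'a, of n k] assms card_roots
    by (simp add: roots)
  have "even ((k - 1) * (k - 2))" using assms(5) by auto
  then have "?l * card (stabilizer PGL2 (\<lambda>g. (`) g) B) = card B * (card B - 1) * (card B - 2)"
    by (simp add: card_stab card_B)
  then have "is_3_design (card (UNIV :: 'a option set)) (card B) ?l UNIV \<B>"
    unfolding assms(9)
    using sharply_transitive_action.is_3_design_orbit[OF sharply_3_transitive_PGL2, of B ?l]
      card_B assms(5) by simp
  then show ?thesis
    using assms(3) by (simp add: card_B card_UNIV_option assms(9) simple_design_mset_set)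
qed

end
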